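(* Let $\Omega\subset\mathbb{R}^n$ be a bounded open set with $|\Omega|=1$ and let $1\le p<+\infty$. For $f\ge0$ in $L^p(\Omega)+L^{p,\infty}(\Omega)$ and $t>0$ put $$K_0(f;t)=t\left(\int_0^{t^{-p}}\big(\psi_{*,\nu}(x)\big)^p\,dx\right)^{\frac1p},\qquad \psi(s)=s^{\frac1p}f_*(s),\ s\in(0,1).$$ Then the $K$-functional of the couple $(L^{p,\infty},L^p)$ is given, up to equivalence, by $K_0$: there are constants $c_1,c_2>0$, independent of $f$ and $t$, with $$c_1K_0(f;t)\le K(f,t;L^{p,\infty},L^p)\le c_2K_0(f;t)$$ for all $t>0$ and all $0\le f\in L^p(\Omega)+L^{p,\infty}(\Omega)$.
   Context: For measurable $f:\Omega\to\mathbb{R}$, $f_*$ is the decreasing rearrangement of $|f|$ on $(0,1)$: $f_*(s)=\inf\{t\ge0:|\{x:|f(x)|>t\}|\le s\}$. $\|f\|_{L^{p,\infty}}=\sup_{0<s<1}s^{1/p}f_*(s)$. For a compatible couple $(X_0,X_1)$, $K(f,t;X_0,X_1)=\inf_{f=f_0+f_1}(\|f_0\|_{X_0}+t\|f_1\|_{X_1})$. $\nu$ is the measure $d\nu=\frac{dx}{x}$ on $(0,1)$, and $\psi_{*,\nu}$ is the decreasing rearrangement of $\psi\ge0$ with respect to $\nu$: $\psi_{*,\nu}(x)=\inf\{\lambda\ge0:\nu(\{s\in(0,1):\psi(s)>\lambda\})\le x\}$, $x>0$. *)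

theory Defs
  imports "HOL-Analysis.Analysis"
begin

text \<open>Norms, rearrangements and \<open>K\<close>-functionals take values in \<open>ennreal\<close>, so that infinite values
  and infima of empty sets are \<open>\<infinity>\<close>.\<close>

text \<open>Powers of extended nonnegative reals, for exponents \<open>a > 0\<close>.\<close>

definition epowr :: "ennreal \<Rightarrow> real \<Rightarrow> ennreal" where
  "epowr x a = (if x = \<infinity> then \<infinity> else ennreal (enn2real x powr a))"

definition decr_rearr :: "'a measure \<Rightarrow> ('a \<Rightarrow> ennreal) \<Rightarrow> real \<Rightarrow> ennreal" where
  "decr_rearr M g s =
     Inf {ennreal l | l. 0 \<le> l \<and> emeasure M {x \<in> space M. g x > ennreal l} \<le> ennreal s}"

definition Lp_norm :: "'a measure \<Rightarrow> real \<Rightarrow> ('a \<Rightarrow> real) \<Rightarrow> ennreal" where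
  "Lp_norm M p f = epowr (\<integral>\<^sup>+x. ennreal (\<bar>f x\<bar> powr p) \<partial>M) (1 / p)"

text \<open>The weak-\<open>L\<^sup>p\<close> quasinorm, for a measure of total mass \<open>1\<close>.\<close>

definition weak_Lp_norm :: "'a measure \<Rightarrow> real \<Rightarrow> ('a \<Rightarrow> real) \<Rightarrow> ennreal" where
  "weak_Lp_norm M p f =
     (SUP s\<in>{0<..<1}. ennreal (s powr (1 / p)) * decr_rearr M (\<lambda>x. ennreal \<bar>f x\<bar>) s)"

text \<open>The function space of an extended (quasi)norm \<open>N\<close>. Its elements are functions rather than
  almost-everywhere classes, so identities between them are stated almost everywhere.\<close>

definition fun_space :: "'a measure \<Rightarrow> (('a \<Rightarrow> real) \<Rightarrow> ennreal) \<Rightarrow> ('a \<Rightarrow> real) set" where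
  "fun_space M N = {f \<in> borel_measurable M. N f < \<infinity>}"

definition decompositions ::
  "'a measure \<Rightarrow> ('a \<Rightarrow> real) set \<Rightarrow> ('a \<Rightarrow> real) set \<Rightarrow> ('a \<Rightarrow> real) \<Rightarrow>
     (('a \<Rightarrow> real) \<times> ('a \<Rightarrow> real)) set" where
  "decompositions M X0 X1 f =
     {(f0, f1). f0 \<in> X0 \<and> f1 \<in> X1 \<and> (AE x in M. f x = f0 x + f1 x)}"

definition sum_space ::
  "'a measure \<Rightarrow> ('a \<Rightarrow> real) set \<Rightarrow> ('a \<Rightarrow> real) set \<Rightarrow> ('a \<Rightarrow> real) set" where
  "sum_space M X0 X1 = {f \<in> borel_measurable M. decompositions M X0 X1 f \<noteq> {}}"

definition K_functional ::
  "'a measure \<Rightarrow> (('a \<Rightarrow> real) \<Rightarrow> ennreal) \<Rightarrow> (('a \<Rightarrow> real) \<Rightarrow> ennreal) \<Rightarrow>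
     ('a \<Rightarrow> real) \<Rightarrow> real \<Rightarrow> ennreal" where
  "K_functional M N0 N1 f t =
     (INF (f0, f1)\<in>decompositions M (fun_space M N0) (fun_space M N1) f. N0 f0 + ennreal t * N1 f1)"

definition nu :: "real measure" where
  "nu = density (lebesgue_on {0<..<1}) (\<lambda>x. ennreal (1 / x))"

definition psi :: "'a measure \<Rightarrow> real \<Rightarrow> ('a \<Rightarrow> real) \<Rightarrow> real \<Rightarrow> ennreal" where
  "psi M p f s = ennreal (s powr (1 / p)) * decr_rearr M (\<lambda>x. ennreal \<bar>f x\<bar>) s"

definition K0 :: "'a measure \<Rightarrow> real \<Rightarrow> ('a \<Rightarrow> real) \<Rightarrow> real \<Rightarrow> ennreal" where
  "K0 M p f t =
     ennreal t * epowr (\<integral>\<^sup>+x\<in>{0<..<t powr (- p)}. epowr (decr_rearr nu (psi M p f) x) p \<partial>lborel) (1 / p)"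

end

theory Submission
  imports Defs
begin

text \<open>
  Passing from \<open>f\<close> to \<open>\<psi>(s) = s^(1/p) f\<^sub>*(s)\<close> turns the couple \<open>(L^(p,\<infinity>), L^p)\<close> on \<open>\<Omega>\<close> into the
  couple \<open>(L^\<infinity>(\<nu>), L^p(\<nu>))\<close> on \<open>(0,1)\<close>: the weak norm of \<open>f\<close> is the supremum of \<open>\<psi>\<close> and
  \<open>\<integral> |f|^p = \<integral> f\<^sub>*^p ds = \<integral> \<psi>^p d\<nu>\<close>. The quantity \<open>K\<^sub>0\<close> is the classical formula, up to constants,
  for the \<open>K\<close>-functional of \<open>\<psi>\<close> in the second couple. All comparisons of integrals go through
  distribution functions (\<open>nn_integral_epowr_le_of_distribution\<close>), by the layer-cake formula, and
  the distribution function of a rearrangement is read off from the Galois connection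
  \<open>f\<^sub>*(s) \<le> l \<longleftrightarrow> |{|f| > l}| \<le> s\<close> (\<open>decr_rearr_le_iff\<close>).

  Lower bound (\<open>K0_le_decomposition\<close>). If \<open>f = f\<^sub>0 + f\<^sub>1\<close>, then
  \<open>f\<^sub>*(s) \<le> f\<^sub>0\<^sub>*(s/2) + f\<^sub>1\<^sub>*(s/2)\<close>, hence \<open>\<psi> \<le> A + h\<close> with the constant \<open>A = 2^(1/p) \<parallel>f\<^sub>0\<parallel>\<close>
  (weak norm) and \<open>h(s) = s^(1/p) f\<^sub>1\<^sub>*(s/2)\<close>. Rearranging preserves this inequality, the constant
  contributes \<open>t \<cdot> A \<cdot> t^-1 = A\<close> to \<open>K\<^sub>0\<close>, and \<open>\<integral> h^p d\<nu> = \<integral> f\<^sub>1\<^sub>*(s/2)^p ds \<le> 2 \<integral> |f\<^sub>1|^p\<close>.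

  Upper bound (\<open>K_functional_le_K0\<close>). Put \<open>\<Lambda> = \<psi>\<^sub>*(t^-p)\<close>; then \<open>\<Lambda> \<le> K\<^sub>0\<close> by monotonicity and the
  set \<open>E = {\<psi> > \<Lambda>}\<close> has \<open>\<nu>(E) \<le> t^-p\<close>. On \<open>(0,1)\<close> one would cut \<open>f\<^sub>*\<close> at \<open>E\<close>; to carry the cut
  over to \<open>\<Omega>\<close> without a measure-preserving map from \<open>\<Omega>\<close> to \<open>(0,1)\<close>, it is made along dyadic
  layers. With \<open>c\<^sub>k = f\<^sub>*(2^-k)\<close>, the layers \<open>{c\<^sub>k < |f| \<le> c_(k+1)}\<close> exhaust \<open>{f \<noteq> 0}\<close> up to a
  null set, the \<open>k\<close>-th one has measure at most \<open>2^-k\<close>, and \<open>f\<^sub>1\<close> is the restriction of \<open>f\<close> to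
  those with \<open>2^(-(k+2)/p) c_(k+1) > \<Lambda>\<close>. For such \<open>k\<close> the interval \<open>(2^(-k-2), 2^(-k-1))\<close> lies in
  \<open>E\<close> and \<open>f\<^sub>* \<ge> c_(k+1)\<close> on it, so it pays for the layer up to a factor of \<open>4\<close>:
  \<open>\<integral> |f\<^sub>1|^p \<le> 4 \<integral>\<^sub>E \<psi>^p d\<nu>\<close> (\<open>nn_integral_high_part_le\<close>), and the right-hand side is at most
  \<open>4 (K\<^sub>0 / t)^p\<close>. On the remaining layers \<open>|f|\<close> is small compared to \<open>\<Lambda>\<close> in the weak norm
  (\<open>weak_Lp_norm_low_part_le\<close>).
\<close>

section \<open>Powers of extended nonnegative reals\<close>

lemma epowr_ennreal [simp]: "0 \<le> r \<Longrightarrow> epowr (ennreal r) a = ennreal (r powr a)"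
  by (simp add: epowr_def)

lemma epowr_top [simp]: "epowr top a = top"
  by (simp add: epowr_def)

lemma epowr_0 [simp]: "epowr 0 a = 0"
  by (simp add: epowr_def)

lemma epowr_mono: "0 < a \<Longrightarrow> x \<le> y \<Longrightarrow> epowr x a \<le> epowr y a"
  by (cases x; cases y) (auto simp: ennreal_leI powr_mono2 top_unique)

lemma epowr_epowr_inverse [simp]:
  assumes "0 < a"
  shows "epowr (epowr x a) (1 / a) = x" "epowr (epowr x (1 / a)) a = x"
  using assms by (cases x; simp add: powr_powr)+

lemma less_epowr_iff:
  assumes "0 < a" "0 \<le> l"
  shows "ennreal l < epowr x a \<longleftrightarrow> ennreal (l powr (1 / a)) < x"
proof -
  have "epowr x a \<le> ennreal l \<longleftrightarrow> x \<le> ennreal (l powr (1 / a))"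
    using epowr_mono[of a x "ennreal (l powr (1 / a))"]
      epowr_mono[of "1 / a" "epowr x a" "ennreal l"] assms
    by (auto simp: powr_powr)
  then show ?thesis
    by (metis not_le)
qed

lemma epowr_mult:
  assumes "0 < a"
  shows "epowr (x * y) a = epowr x a * epowr y a"
proof -
  have top: "epowr (top * y) a = top * epowr y a" for y
    by (cases y) (auto simp: ennreal_top_mult)
  show ?thesis
  proof (cases "x = top \<or> y = top")
    case True
    then show ?thesis
      using top[of x] top[of y] by (auto simp: mult.commute)
  next
    case False
    then obtain r s where "0 \<le> r" "0 \<le> s" "x = ennreal r" "y = ennreal s"
      by (metis ennreal_cases infinity_ennreal_def)
    then show ?thesis
      by (simp add: powr_mult flip: ennreal_mult)
  qed
qed

text \<open>A convexity-free substitute for Minkowski's inequality, valid for every exponent \<open>a > 0\<close>: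
  the sum is at most twice the maximum. It serves below for \<open>a = p\<close> and for \<open>a = 1 / p\<close>.\<close>

lemma epowr_add_le:
  assumes "0 < a"
  shows "epowr (x + y) a \<le> ennreal (2 powr a) * (epowr x a + epowr y a)"
proof -
  have "epowr (x + y) a \<le> epowr (2 * max x y) a"
    by (intro epowr_mono assms) (metis add_mono max.cobounded1 max.cobounded2 mult_2)
  also have "\<dots> = ennreal (2 powr a) * epowr (max x y) a"
    using epowr_ennreal[of 2 a] by (simp add: epowr_mult[OF assms])
  also have "\<dots> \<le> ennreal (2 powr a) * (epowr x a + epowr y a)"
    by (intro mult_left_mono) (auto simp: max_def add_increasing add_increasing2)
  finally show ?thesis .
qed

lemma borel_measurable_epowr [measurable]:
  assumes [measurable]: "g \<in> borel_measurable M"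
  shows "(\<lambda>x. epowr (g x) a) \<in> borel_measurable M"
  unfolding epowr_def by measurable

section \<open>The distribution function determines integrals\<close>

text \<open>The length of the interval from \<open>0\<close> to \<open>c\<close>, with \<open>c = \<infinity>\<close> allowed. Levels are real numbers
  while values and measures are in \<open>ennreal\<close>; this is the passage between the two.\<close>

lemma emeasure_levels_below:
  "emeasure lborel {y. 0 < y \<and> ennreal y < c} = c"
proof (cases c)
  case (real r)
  then have "{y. 0 < y \<and> ennreal y < c} = {0<..<r}"
    by (auto simp: ennreal_less_iff)
  then show ?thesis
    using real by simp
next
  case top
  have "emeasure lborel {0::real<..} = top"
  proof (rule ccontr)
    assume *: "emeasure lborel {0::real<..} \<noteq> top"
    then obtain r where r: "0 \<le> r" "emeasure lborel {0::real<..} = ennreal r"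
      by (metis ennreal_cases infinity_ennreal_def)
    have "emeasure lborel {0<..<r+1} \<le> emeasure lborel {0::real<..}"
      by (intro emeasure_mono) auto
    then show False
      using r by (simp add: ennreal_le_iff)
  qed
  then show ?thesis
    using top by (simp add: greaterThan_def)
qed

text \<open>Tonelli's theorem for the region \<open>{(x, y). 0 < y < g x}\<close> under the graph of \<open>g\<close>.\<close>

lemma nn_integral_layer_cake:
  fixes g :: "'a \<Rightarrow> ennreal"
  assumes "sigma_finite_measure M" and [measurable]: "g \<in> borel_measurable M"
  shows "(\<integral>\<^sup>+x. g x \<partial>M) =
      (\<integral>\<^sup>+y. indicator {0<..} y * emeasure M {x \<in> space M. ennreal y < g x} \<partial>lborel)"
    and "(\<lambda>y. indicator {0<..} y * emeasure M {x \<in> space M. ennreal y < g x})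
      \<in> borel_measurable (lborel :: real measure)"
proof -
  interpret M: sigma_finite_measure M by fact
  interpret P: pair_sigma_finite M "lborel :: real measure" ..
  define F where "F x y = (indicator {y. 0 < y \<and> ennreal y < g x} y :: ennreal)" for x and y :: real
  have [measurable]: "case_prod F \<in> borel_measurable (M \<Otimes>\<^sub>M lborel)"
    unfolding F_def indicator_def mem_Collect_eq by measurable
  have inner: "(\<integral>\<^sup>+x. F x y \<partial>M) = indicator {0<..} y * emeasure M {x \<in> space M. ennreal y < g x}"
    for y :: real
  proof -
    have "(\<integral>\<^sup>+x. F x y \<partial>M) =
        (\<integral>\<^sup>+x. indicator {0<..} y * indicator {x \<in> space M. ennreal y < g x} x \<partial>M)"
      by (intro nn_integral_cong) (auto simp: F_def indicator_def)
    then show ?thesis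
      by (simp add: nn_integral_cmult)
  qed
  have "(\<integral>\<^sup>+x. g x \<partial>M) = (\<integral>\<^sup>+x. \<integral>\<^sup>+y. F x y \<partial>lborel \<partial>M)"
  proof (intro nn_integral_cong)
    fix x assume x: "x \<in> space M"
    have "(\<integral>\<^sup>+y. F x y \<partial>lborel) = (\<integral>\<^sup>+y. indicator {y. 0 < y \<and> ennreal y < g x} y \<partial>lborel)"
      by (simp add: F_def)
    also have "\<dots> = g x"
      by (simp add: emeasure_levels_below)
    finally show "g x = (\<integral>\<^sup>+y. F x y \<partial>lborel)" ..
  qed
  also have "\<dots> = (\<integral>\<^sup>+y. \<integral>\<^sup>+x. F x y \<partial>M \<partial>lborel)"
    by (rule P.Fubini'[symmetric]) measurable
  finally show "(\<integral>\<^sup>+x. g x \<partial>M) =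
      (\<integral>\<^sup>+y. indicator {0<..} y * emeasure M {x \<in> space M. ennreal y < g x} \<partial>lborel)"
    by (simp add: inner)
  have "(\<lambda>y. \<integral>\<^sup>+x. F x y \<partial>M) \<in> borel_measurable lborel"
    by measurable
  then show "(\<lambda>y. indicator {0<..} y * emeasure M {x \<in> space M. ennreal y < g x})
      \<in> borel_measurable (lborel :: real measure)"
    by (simp add: inner)
qed

text \<open>The two functions may live on different measure spaces. This is how integrals over \<open>\<Omega>\<close>, over
  \<open>(0,1)\<close> with \<open>dx\<close> or \<open>dx / x\<close>, and over \<open>(0,\<infinity>)\<close> are compared with each other.\<close>

lemma nn_integral_epowr_le_of_distribution:
  fixes g :: "'a \<Rightarrow> ennreal" and h :: "'b \<Rightarrow> ennreal" and C :: ennreal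
  assumes M: "sigma_finite_measure M" and [measurable]: "g \<in> borel_measurable M"
    and N: "sigma_finite_measure N" and [measurable]: "h \<in> borel_measurable N"
    and p: "0 < p"
    and dist: "\<And>l. 0 < l \<Longrightarrow> emeasure M {x \<in> space M. ennreal l < g x}
      \<le> C * emeasure N {x \<in> space N. ennreal l < h x}"
  shows "(\<integral>\<^sup>+x. epowr (g x) p \<partial>M) \<le> C * (\<integral>\<^sup>+x. epowr (h x) p \<partial>N)"
proof -
  have "(\<integral>\<^sup>+x. epowr (g x) p \<partial>M)
      = (\<integral>\<^sup>+y. indicator {0<..} y * emeasure M {x \<in> space M. ennreal y < epowr (g x) p} \<partial>lborel)"
    by (rule nn_integral_layer_cake(1)[OF M]) measurable
  also have "\<dots> \<le>
      (\<integral>\<^sup>+y. C * (indicator {0<..} y * emeasure N {x \<in> space N. ennreal y < epowr (h x) p}) \<partial>lborel)"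
    using dist p by (intro nn_integral_mono) (auto simp: indicator_def less_epowr_iff)
  also have "\<dots> = C * (\<integral>\<^sup>+y. indicator {0<..} y * emeasure N {x \<in> space N. ennreal y < epowr (h x) p} \<partial>lborel)"
    by (intro nn_integral_cmult nn_integral_layer_cake(2)[OF N]) measurable
  also have "(\<integral>\<^sup>+y. indicator {0<..} y * emeasure N {x \<in> space N. ennreal y < epowr (h x) p} \<partial>lborel)
      = (\<integral>\<^sup>+x. epowr (h x) p \<partial>N)"
    by (rule nn_integral_layer_cake(1)[OF N, symmetric]) measurable
  finally show ?thesis .
qed

section \<open>Decreasing rearrangements\<close>

text \<open>The infimum that defines the rearrangement is attained if it is finite, because the
  distribution function is right-continuous: \<open>{g > l}\<close> is the increasing union of the sets
  \<open>{g > l + 1/(n+1)}\<close>.\<close>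

lemma decr_rearr_le_iff:
  assumes [measurable]: "g \<in> borel_measurable M" and l: "0 \<le> l"
  shows "decr_rearr M g s \<le> ennreal l \<longleftrightarrow> emeasure M {x \<in> space M. ennreal l < g x} \<le> ennreal s"
proof
  assume le: "decr_rearr M g s \<le> ennreal l"
  define A where "A n = {x \<in> space M. ennreal (l + 1 / real (Suc n)) < g x}" for n
  have "emeasure M (A n) \<le> ennreal s" for n
  proof -
    have "decr_rearr M g s < ennreal (l + 1 / real (Suc n))"
      using le l by (elim le_less_trans) (simp add: ennreal_less_iff)
    then obtain l' where l': "0 \<le> l'" "emeasure M {x \<in> space M. ennreal l' < g x} \<le> ennreal s"
      "ennreal l' < ennreal (l + 1 / real (Suc n))"
      unfolding decr_rearr_def Inf_less_iff by auto
    have "emeasure M (A n) \<le> emeasure M {x \<in> space M. ennreal l' < g x}"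
      using l'(3) by (intro emeasure_mono) (auto simp: A_def)
    with l' show ?thesis by simp
  qed
  moreover have "incseq A"
  proof (intro incseq_SucI subsetI)
    fix n x assume "x \<in> A n"
    moreover have "ennreal (l + 1 / real (Suc (Suc n))) \<le> ennreal (l + 1 / real (Suc n))"
      by (intro ennreal_leI) (simp add: frac_le)
    ultimately show "x \<in> A (Suc n)"
      unfolding A_def by (auto elim: le_less_trans)
  qed
  moreover have "{x \<in> space M. ennreal l < g x} = (\<Union>n. A n)"
  proof (intro equalityI subsetI)
    fix x assume x: "x \<in> {x \<in> space M. ennreal l < g x}"
    then obtain r where r: "l < r" "ennreal r < g x"
      by (metis (no_types, lifting) dense ennreal_less_iff ennreal_cases l less_top mem_Collect_eq
          order_less_le_trans top_greatest infinity_ennreal_def)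
    obtain n where "1 / real (Suc n) < r - l"
      using reals_Archimedean[of "r - l"] r by (auto simp: inverse_eq_divide)
    then have "ennreal (l + 1 / real (Suc n)) \<le> ennreal r"
      by (intro ennreal_leI) simp
    with r x show "x \<in> (\<Union>n. A n)"
      by (auto simp: A_def intro: le_less_trans)
  next
    fix x assume "x \<in> (\<Union>n. A n)"
    then obtain n where "x \<in> space M" "ennreal (l + 1 / real (Suc n)) < g x"
      by (auto simp: A_def)
    moreover have "ennreal l \<le> ennreal (l + 1 / real (Suc n))"
      by (intro ennreal_leI) simp
    ultimately show "x \<in> {x \<in> space M. ennreal l < g x}"
      by (auto elim: le_less_trans)
  qed
  moreover have "range A \<subseteq> sets M"
    by (auto simp: A_def)
  ultimately show "emeasure M {x \<in> space M. ennreal l < g x} \<le> ennreal s"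
    using SUP_emeasure_incseq[of A M] by (simp flip: \<open>_ = (\<Union>n. A n)\<close>) (metis SUP_least)
next
  assume "emeasure M {x \<in> space M. ennreal l < g x} \<le> ennreal s"
  then show "decr_rearr M g s \<le> ennreal l"
    unfolding decr_rearr_def using l by (intro Inf_lower) auto
qed

lemma less_decr_rearr_iff:
  assumes "g \<in> borel_measurable M" "0 \<le> l"
  shows "ennreal l < decr_rearr M g s \<longleftrightarrow> ennreal s < emeasure M {x \<in> space M. ennreal l < g x}"
  using decr_rearr_le_iff[OF assms] by (metis not_le)

lemma decr_rearr_antimono: "s \<le> s' \<Longrightarrow> decr_rearr M g s' \<le> decr_rearr M g s"
  unfolding decr_rearr_def
  by (intro Inf_superset_mono) (blast intro: order_trans ennreal_leI)

lemma borel_measurable_decr_rearr [measurable]: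
  assumes "g \<in> borel_measurable M"
  shows "decr_rearr M g \<in> borel_measurable borel"
proof (rule borel_measurableI_greater)
  fix y :: ennreal
  show "{s \<in> space borel. y < decr_rearr M g s} \<in> sets borel"
  proof (cases y)
    case (real r)
    then show ?thesis
      by (simp add: less_decr_rearr_iff[OF assms])
  qed simp
qed

text \<open>If \<open>|f|\<close> exceeds \<open>a + b\<close>, then \<open>|f\<^sub>0| > a\<close> or \<open>|f\<^sub>1| > b\<close>; each of the two summands gets
  half of the measure \<open>s\<close>.\<close>

lemma decr_rearr_add_le:
  assumes [measurable]: "f \<in> borel_measurable M" "f0 \<in> borel_measurable M" "f1 \<in> borel_measurable M"
    and sum: "AE x in M. f x = f0 x + f1 x" and s: "0 \<le> s"
  shows "decr_rearr M (\<lambda>x. ennreal \<bar>f x\<bar>) s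
    \<le> decr_rearr M (\<lambda>x. ennreal \<bar>f0 x\<bar>) (s / 2) + decr_rearr M (\<lambda>x. ennreal \<bar>f1 x\<bar>) (s / 2)"
    (is "_ \<le> ?a + ?b")
proof (cases "?a = top \<or> ?b = top")
  case False
  then obtain a b where ab: "0 \<le> a" "0 \<le> b" "?a = ennreal a" "?b = ennreal b"
    by (metis ennreal_cases)
  let ?A = "{x \<in> space M. ennreal a < ennreal \<bar>f0 x\<bar>}"
  let ?B = "{x \<in> space M. ennreal b < ennreal \<bar>f1 x\<bar>}"
  have "emeasure M {x \<in> space M. ennreal (a + b) < ennreal \<bar>f x\<bar>} \<le> emeasure M (?A \<union> ?B)"
    using sum ab(1,2)
    by (intro emeasure_mono_AE) (auto simp: ennreal_less_iff simp del: ennreal_plus elim!: eventually_mono)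
  also have "\<dots> \<le> emeasure M ?A + emeasure M ?B"
    by (rule emeasure_subadditive) measurable
  also have "\<dots> \<le> ennreal (s / 2) + ennreal (s / 2)"
    using ab by (intro add_mono) (simp_all flip: decr_rearr_le_iff)
  also have "\<dots> = ennreal s"
    using s by (simp flip: ennreal_plus)
  finally have "decr_rearr M (\<lambda>x. ennreal \<bar>f x\<bar>) s \<le> ennreal (a + b)"
    using ab by (subst decr_rearr_le_iff) auto
  then show ?thesis
    using ab by (simp add: ennreal_plus)
qed auto

lemma decr_rearr_const_add_le:
  assumes [measurable]: "g \<in> borel_measurable M" "h \<in> borel_measurable M"
    and le: "\<And>x. x \<in> space M \<Longrightarrow> g x \<le> A + h x"
  shows "decr_rearr M g s \<le> A + decr_rearr M h s"
proof (cases "A = top \<or> decr_rearr M h s = top")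
  case False
  then obtain a b where ab: "0 \<le> a" "0 \<le> b" "A = ennreal a" "decr_rearr M h s = ennreal b"
    by (metis ennreal_cases)
  have "emeasure M {x \<in> space M. ennreal (a + b) < g x} \<le> emeasure M {x \<in> space M. ennreal b < h x}"
  proof (intro emeasure_mono subsetI CollectI conjI)
    fix x assume "x \<in> {x \<in> space M. ennreal (a + b) < g x}"
    then have x: "x \<in> space M" "ennreal a + ennreal b < A + h x"
      using less_le_trans[OF _ le[of x], of "ennreal a + ennreal b"] ab(1,2) by auto
    then show "ennreal b < h x"
      using ab(3) by (metis add_left_mono not_le)
    show "x \<in> space M" by fact
  qed measurable
  also have "\<dots> \<le> ennreal s"
    using ab by (simp flip: decr_rearr_le_iff)
  finally show ?thesis
    using ab by (simp add: decr_rearr_le_iff flip: ennreal_plus)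
qed auto

text \<open>The set where the rearrangement exceeds \<open>l\<close> is an interval whose length is the measure of
  \<open>{h > l}\<close>.\<close>

lemma nn_integral_decr_rearr_le:
  assumes N: "sigma_finite_measure N" and [measurable]: "h \<in> borel_measurable N" and p: "0 < p"
  shows "(\<integral>\<^sup>+x\<in>{0<..<T}. epowr (decr_rearr N h x) p \<partial>lborel) \<le> (\<integral>\<^sup>+x. epowr (h x) p \<partial>N)"
proof -
  have "(\<integral>\<^sup>+x. epowr (decr_rearr N h x * indicator {0<..<T} x) p \<partial>lborel)
      \<le> 1 * (\<integral>\<^sup>+x. epowr (h x) p \<partial>N)"
  proof (rule nn_integral_epowr_le_of_distribution[OF _ _ N _ p])
    fix l :: real assume l: "0 < l"
    have "emeasure lborel {x \<in> space lborel. ennreal l < decr_rearr N h x * indicator {0<..<T} x}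
        \<le> emeasure lborel {y. 0 < y \<and> ennreal y < emeasure N {x \<in> space N. ennreal l < h x}}"
      using l by (intro emeasure_mono) (auto simp: indicator_def less_decr_rearr_iff split: if_splits)
    then show "emeasure lborel {x \<in> space lborel. ennreal l < decr_rearr N h x * indicator {0<..<T} x}
        \<le> 1 * emeasure N {x \<in> space N. ennreal l < h x}"
      by (simp add: emeasure_levels_below)
  qed (auto intro: lborel.sigma_finite_measure_axioms)
  also have "(\<integral>\<^sup>+x. epowr (decr_rearr N h x * indicator {0<..<T} x) p \<partial>lborel)
      = (\<integral>\<^sup>+x\<in>{0<..<T}. epowr (decr_rearr N h x) p \<partial>lborel)"
    by (intro nn_integral_cong) (auto simp: indicator_def)
  finally show ?thesis by simp
qed

text \<open>The Hardy-Littlewood inequality for the indicator of a set: \<open>E \<inter> {h > l}\<close> has measure at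
  most \<open>min T (\<mu>{h > l})\<close>, which is the length of the set of \<open>x < T\<close> where the rearrangement
  exceeds \<open>l\<close>.\<close>

lemma nn_integral_le_decr_rearr:
  assumes N: "sigma_finite_measure N" and [measurable]: "h \<in> borel_measurable N" "E \<in> sets N"
    and p: "0 < p" and E: "emeasure N E \<le> ennreal T"
  shows "(\<integral>\<^sup>+x\<in>E. epowr (h x) p \<partial>N) \<le> (\<integral>\<^sup>+x\<in>{0<..<T}. epowr (decr_rearr N h x) p \<partial>lborel)"
proof -
  have "(\<integral>\<^sup>+x. epowr (h x * indicator E x) p \<partial>N)
      \<le> 1 * (\<integral>\<^sup>+x. epowr (decr_rearr N h x * indicator {0<..<T} x) p \<partial>lborel)"
  proof (rule nn_integral_epowr_le_of_distribution[OF N _ _ _ p])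
    fix l :: real assume l: "0 < l"
    let ?d = "emeasure N {x \<in> space N. ennreal l < h x}"
    have "emeasure N {x \<in> space N. ennreal l < h x * indicator E x} \<le> min (emeasure N E) ?d"
      by (auto intro!: emeasure_mono simp: indicator_def split: if_splits)
    also have "\<dots> \<le> min (ennreal T) ?d"
      using E by (auto simp: min_def)
    also have "\<dots> = emeasure lborel {y. 0 < y \<and> ennreal y < min (ennreal T) ?d}"
      by (simp only: emeasure_levels_below)
    also have "\<dots> \<le> emeasure lborel {x \<in> space lborel. ennreal l < decr_rearr N h x * indicator {0<..<T} x}"
      using l by (intro emeasure_mono)
        (auto simp: indicator_def less_decr_rearr_iff ennreal_less_iff)
    finally show "emeasure N {x \<in> space N. ennreal l < h x * indicator E x}
        \<le> 1 * emeasure lborel {x \<in> space lborel. ennreal l < decr_rearr N h x * indicator {0<..<T} x}"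
      by simp
  qed (auto intro: lborel.sigma_finite_measure_axioms)
  also have "(\<integral>\<^sup>+x. epowr (decr_rearr N h x * indicator {0<..<T} x) p \<partial>lborel)
      = (\<integral>\<^sup>+x\<in>{0<..<T}. epowr (decr_rearr N h x) p \<partial>lborel)"
    by (intro nn_integral_cong) (auto simp: indicator_def)
  also have "(\<integral>\<^sup>+x. epowr (h x * indicator E x) p \<partial>N) = (\<integral>\<^sup>+x\<in>E. epowr (h x) p \<partial>N)"
    by (intro nn_integral_cong) (auto simp: indicator_def)
  finally show ?thesis by simp
qed

section \<open>The measure \<open>dx / x\<close> and the weighted rearrangement\<close>

lemma space_nu [simp]: "space nu = {0<..<1}"
  by (simp add: nu_def)

lemma borel_measurable_lebesgue_onI:
  "g \<in> borel_measurable borel \<Longrightarrow> g \<in> borel_measurable (lebesgue_on S)"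
  by (intro measurable_restrict_space1 measurable_completion) simp

lemma borel_measurable_nuI: "g \<in> borel_measurable borel \<Longrightarrow> g \<in> borel_measurable nu"
  using borel_measurable_lebesgue_onI by (simp add: nu_def)

lemma sigma_finite_unit_interval: "sigma_finite_measure (lebesgue_on {0<..<1::real})"
  by (intro finite_measure.axioms finite_measure_lebesgue_on) (simp flip: box_real)

lemma sigma_finite_nu: "sigma_finite_measure nu"
proof -
  interpret sigma_finite_measure "lebesgue_on {0<..<1::real}"
    by (rule sigma_finite_unit_interval)
  show ?thesis
    unfolding nu_def
    by (subst sigma_finite_iff_density_finite) (auto intro: borel_measurable_lebesgue_onI)
qed

text \<open>The density \<open>1 / s\<close> of \<open>\<nu>\<close> cancels the \<open>p\<close>-th power of the weight \<open>s^(1/p)\<close>.\<close>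

lemma nn_integral_nu_weighted:
  assumes [measurable]: "g \<in> borel_measurable borel" "E \<in> sets borel" and p: "0 < p"
  shows "(\<integral>\<^sup>+s\<in>E. epowr (ennreal (s powr (1 / p)) * g s) p \<partial>nu)
    = (\<integral>\<^sup>+s\<in>E. epowr (g s) p \<partial>lebesgue_on {0<..<1})"
proof -
  have "(\<integral>\<^sup>+s\<in>E. epowr (ennreal (s powr (1 / p)) * g s) p \<partial>nu)
    = (\<integral>\<^sup>+s. ennreal (1 / s) * (epowr (ennreal (s powr (1 / p)) * g s) p * indicator E s)
        \<partial>lebesgue_on {0<..<1})"
    unfolding nu_def by (intro nn_integral_density borel_measurable_lebesgue_onI) measurable
  also have "\<dots> = (\<integral>\<^sup>+s\<in>E. epowr (g s) p \<partial>lebesgue_on {0<..<1})"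
  proof (intro nn_integral_cong)
    fix s :: real assume "s \<in> space (lebesgue_on {0<..<1})"
    then have s: "0 < s" by simp
    then have "ennreal (1 / s) * ennreal s = 1"
      by (simp flip: ennreal_mult)
    then show "ennreal (1 / s) * (epowr (ennreal (s powr (1 / p)) * g s) p * indicator E s)
        = epowr (g s) p * indicator E s"
      using s p by (simp add: epowr_mult powr_powr mult.assoc[symmetric])
  qed
  finally show ?thesis .
qed

lemma borel_measurable_psi [measurable]:
  "f \<in> borel_measurable M \<Longrightarrow> psi M p f \<in> borel_measurable borel"
  unfolding psi_def by measurable

section \<open>The lower bound\<close>

text \<open>The dilation by \<open>2\<close> doubles the length of every set where the rearrangement exceeds a level.\<close>

lemma nn_integral_dilated_decr_rearr_le:
  assumes M: "sigma_finite_measure M" and [measurable]: "g \<in> borel_measurable M" and p: "0 < p"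
  shows "(\<integral>\<^sup>+s. epowr (decr_rearr M g (s / 2)) p \<partial>lebesgue_on {0<..<1}) \<le> 2 * (\<integral>\<^sup>+x. epowr (g x) p \<partial>M)"
proof (rule nn_integral_epowr_le_of_distribution[OF sigma_finite_unit_interval _ M _ p])
  fix l :: real assume l: "0 < l"
  define d where "d = emeasure M {x \<in> space M. ennreal l < g x}"
  have half: "ennreal (s / 2) < d \<longleftrightarrow> ennreal s < 2 * d" if "0 < s" for s
  proof (cases d)
    case (real r)
    then have "2 * d = ennreal (2 * r)"
      by (simp add: ennreal_mult)
    then show ?thesis
      using real that by (auto simp: ennreal_less_iff)
  qed (simp add: ennreal_mult_top)
  have "emeasure (lebesgue_on {0<..<1}) {s \<in> space (lebesgue_on {0<..<1}). ennreal l < decr_rearr M g (s / 2)}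
      = emeasure (lebesgue_on {0<..<1}) {s. 0 < s \<and> s < 1 \<and> ennreal s < 2 * d}"
    using l by (intro arg_cong2[where f=emeasure]) (auto simp: less_decr_rearr_iff half simp flip: d_def)
  also have "\<dots> = emeasure lborel {s. 0 < s \<and> s < 1 \<and> ennreal s < 2 * d}"
    by (subst emeasure_restrict_space) auto
  also have "\<dots> \<le> emeasure lborel {s. 0 < s \<and> ennreal s < 2 * d}"
    by (intro emeasure_mono) auto
  also have "\<dots> = 2 * d"
    by (rule emeasure_levels_below)
  finally show "emeasure (lebesgue_on {0<..<1}) {s \<in> space (lebesgue_on {0<..<1}). ennreal l < decr_rearr M g (s / 2)}
      \<le> 2 * emeasure M {x \<in> space M. ennreal l < g x}"
    by (simp add: d_def)
qed (auto intro!: borel_measurable_lebesgue_onI)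

text \<open>The constant is \<open>2 \<cdot> 2^(1/p) \<cdot> 2^(1/p)\<close>: the first factor comes from the inequality for
  powers of sums with exponent \<open>p\<close>, the second from the dilation by \<open>2\<close> in the rearrangement of a
  sum, the third from the inequality with exponent \<open>1 / p\<close>.\<close>

lemma K0_le_decomposition:
  assumes M: "sigma_finite_measure M"
    and [measurable]: "f \<in> borel_measurable M" "f0 \<in> borel_measurable M" "f1 \<in> borel_measurable M"
    and sum: "AE x in M. f x = f0 x + f1 x"
    and p: "0 < p" and t: "0 < t"
  shows "K0 M p f t
    \<le> ennreal (2 * 4 powr (1 / p)) * (weak_Lp_norm M p f0 + ennreal t * Lp_norm M p f1)"
proof -
  define W where "W = weak_Lp_norm M p f0"
  define F where "F = (\<integral>\<^sup>+x. epowr (ennreal \<bar>f1 x\<bar>) p \<partial>M)"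
  define T where "T = t powr (- p)"
  define A where "A = ennreal (2 powr (1 / p)) * W"
  define h where "h s = ennreal (s powr (1 / p)) * decr_rearr M (\<lambda>x. ennreal \<bar>f1 x\<bar>) (s / 2)" for s
  define I where "I = (\<integral>\<^sup>+x\<in>{0<..<T}. epowr (decr_rearr nu (psi M p f) x) p \<partial>lborel)"
  have [measurable]: "h \<in> borel_measurable borel"
    unfolding h_def by measurable
  have Lp: "Lp_norm M p f1 = epowr F (1 / p)"
    by (simp add: Lp_norm_def F_def)
  have Ap: "epowr A p = 2 * epowr W p"
    using p by (simp add: A_def epowr_mult powr_powr)
  have psi_le: "psi M p f s \<le> A + h s" if s: "0 < s" "s < 1" for s
  proof -
    let ?w = "ennreal (s powr (1 / p))"
    have "psi M p f s \<le> ?w * (decr_rearr M (\<lambda>x. ennreal \<bar>f0 x\<bar>) (s / 2) + decr_rearr M (\<lambda>x. ennreal \<bar>f1 x\<bar>) (s / 2))"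
      unfolding psi_def using s by (intro mult_left_mono decr_rearr_add_le sum) auto
    also have "\<dots> = ennreal (2 powr (1 / p))
        * (ennreal ((s / 2) powr (1 / p)) * decr_rearr M (\<lambda>x. ennreal \<bar>f0 x\<bar>) (s / 2)) + h s"
      using s by (simp add: h_def distrib_left powr_divide mult.assoc[symmetric] flip: ennreal_mult)
    also have "\<dots> \<le> A + h s"
      unfolding A_def W_def weak_Lp_norm_def using s
      by (intro add_right_mono mult_left_mono SUP_upper) auto
    finally show ?thesis .
  qed
  have "(\<integral>\<^sup>+x\<in>{0<..<T}. epowr (decr_rearr nu h x) p \<partial>lborel) \<le> (\<integral>\<^sup>+s. epowr (h s) p \<partial>nu)"
    using sigma_finite_nu p by (intro nn_integral_decr_rearr_le borel_measurable_nuI) auto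
  also have "\<dots> = (\<integral>\<^sup>+s. epowr (decr_rearr M (\<lambda>x. ennreal \<bar>f1 x\<bar>) (s / 2)) p \<partial>lebesgue_on {0<..<1})"
    using nn_integral_nu_weighted[of "\<lambda>s. decr_rearr M (\<lambda>x. ennreal \<bar>f1 x\<bar>) (s / 2)" UNIV p] p
    by (simp add: h_def)
  also have "\<dots> \<le> 2 * F"
    unfolding F_def by (intro nn_integral_dilated_decr_rearr_le M p) measurable
  \<comment> \<open>With \<open>A^p = 2 W^p\<close>, the same factor \<open>2\<close> stands at both contributions and can be taken out.\<close>
  finally have h_int: "(\<integral>\<^sup>+x\<in>{0<..<T}. epowr (decr_rearr nu h x) p \<partial>lborel) \<le> 2 * F" .
  have "I \<le> (\<integral>\<^sup>+x. ennreal (2 powr p) * (epowr A p * indicator {0<..<T} x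
      + epowr (decr_rearr nu h x) p * indicator {0<..<T} x) \<partial>lborel)"
    unfolding I_def
  proof (intro nn_integral_mono)
    fix x
    have "epowr (decr_rearr nu (psi M p f) x) p \<le> epowr (A + decr_rearr nu h x) p"
      using psi_le p by (intro epowr_mono decr_rearr_const_add_le borel_measurable_nuI) auto
    also note epowr_add_le[OF p]
    finally show "epowr (decr_rearr nu (psi M p f) x) p * indicator {0<..<T} x
        \<le> ennreal (2 powr p) * (epowr A p * indicator {0<..<T} x
          + epowr (decr_rearr nu h x) p * indicator {0<..<T} x)"
      by (auto simp: indicator_def)
  qed
  also have "\<dots> = ennreal (2 powr p) * (epowr A p * ennreal T
      + (\<integral>\<^sup>+x\<in>{0<..<T}. epowr (decr_rearr nu h x) p \<partial>lborel))"
    using borel_measurable_nuI[OF \<open>h \<in> _\<close>]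
    by (simp add: nn_integral_cmult nn_integral_add nn_integral_cmult_indicator T_def)
  also have "\<dots> \<le> ennreal (2 powr p) * (2 * epowr W p * ennreal T + 2 * F)"
    using h_int by (intro mult_left_mono add_left_mono) (auto simp: Ap)
  also have "\<dots> = ennreal (2 powr p) * (2 * (epowr W p * ennreal T + F))"
    by (simp add: distrib_left mult.assoc)
  finally have I_le: "I \<le> ennreal (2 powr p) * (2 * (epowr W p * ennreal T + F))" .
  have two: "epowr 2 (1 / p) = ennreal (2 powr (1 / p))"
    using epowr_ennreal[of 2 "1 / p"] by simp
  have "epowr I (1 / p) \<le> 2 * (ennreal (2 powr (1 / p)) * epowr (epowr W p * ennreal T + F) (1 / p))"
    using epowr_mono[OF _ I_le, of "1 / p"] p
    by (simp add: epowr_mult powr_powr two del: distrib_left_numeral)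
  also have "\<dots> \<le> 2 * (ennreal (2 powr (1 / p)) * (ennreal (2 powr (1 / p))
      * (epowr (epowr W p * ennreal T) (1 / p) + epowr F (1 / p))))"
    using p by (intro mult_left_mono epowr_add_le) auto
  also have "epowr (epowr W p * ennreal T) (1 / p) = W * ennreal (1 / t)"
    using p t powr_neg_one[of t] by (simp add: epowr_mult T_def powr_powr)
  finally have "ennreal t * epowr I (1 / p) \<le> ennreal t * (2 * (ennreal (2 powr (1 / p))
      * (ennreal (2 powr (1 / p)) * (W * ennreal (1 / t) + Lp_norm M p f1))))"
    by (intro mult_left_mono) (simp_all add: Lp)
  also have "\<dots> = 2 * (ennreal (2 powr (1 / p)) * ennreal (2 powr (1 / p)))
      * (ennreal t * ennreal (1 / t) * W + ennreal t * Lp_norm M p f1)"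
    by (simp add: distrib_left mult_ac)
  also have "ennreal t * ennreal (1 / t) = 1"
    using t by (simp flip: ennreal_mult)
  also have "2 * (ennreal (2 powr (1 / p)) * ennreal (2 powr (1 / p))) = ennreal (2 * 4 powr (1 / p))"
    using powr_mult[of 2 2 "1 / p"] by (simp add: ennreal_mult)
  finally show ?thesis
    by (simp add: K0_def I_def W_def T_def)
qed

section \<open>The upper bound\<close>

definition dyadic_level :: "'a measure \<Rightarrow> ('a \<Rightarrow> ennreal) \<Rightarrow> nat \<Rightarrow> ennreal" where
  "dyadic_level M g k = decr_rearr M g ((1 / 2) ^ k)"

definition dyadic_layer :: "'a measure \<Rightarrow> ('a \<Rightarrow> ennreal) \<Rightarrow> nat \<Rightarrow> 'a set" where
  "dyadic_layer M g k = {x \<in> space M. dyadic_level M g k < g x \<and> g x \<le> dyadic_level M g (Suc k)}"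

text \<open>The condition makes \<open>s^(1/p) g\<^sub>*(s)\<close> exceed \<open>\<Lambda>\<close> on the whole interval
  \<open>(2^(-k-2), 2^(-k-1))\<close>: this product is at least the weight at the left end times \<open>g\<^sub>*\<close> at the
  right end.\<close>

definition high_indices :: "'a measure \<Rightarrow> real \<Rightarrow> ('a \<Rightarrow> ennreal) \<Rightarrow> ennreal \<Rightarrow> nat set" where
  "high_indices M p g \<Lambda> =
    {k. \<Lambda> < ennreal (((1 / 2) ^ (k + 2)) powr (1 / p)) * dyadic_level M g (Suc k)}"

definition high_part :: "'a measure \<Rightarrow> real \<Rightarrow> ('a \<Rightarrow> ennreal) \<Rightarrow> ennreal \<Rightarrow> 'a set" where
  "high_part M p g \<Lambda> = (\<Union>k\<in>high_indices M p g \<Lambda>. dyadic_layer M g k)"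

lemma sets_dyadic_layer [measurable]:
  "g \<in> borel_measurable M \<Longrightarrow> dyadic_layer M g k \<in> sets M"
proof -
  assume [measurable]: "g \<in> borel_measurable M"
  have "{x \<in> space M. a < g x \<and> g x \<le> b} \<in> sets M" for a b :: ennreal
    by measurable
  then show ?thesis
    unfolding dyadic_layer_def .
qed

lemma sets_high_part [measurable]:
  "g \<in> borel_measurable M \<Longrightarrow> high_part M p g \<Lambda> \<in> sets M"
  unfolding high_part_def by (intro sets.countable_UN' sets_dyadic_layer) auto

lemma dyadic_level_mono: "j \<le> k \<Longrightarrow> dyadic_level M g j \<le> dyadic_level M g k"
  unfolding dyadic_level_def by (intro decr_rearr_antimono power_decreasing) auto

lemma emeasure_above_dyadic_level:
  assumes "g \<in> borel_measurable M"
  shows "emeasure M {x \<in> space M. dyadic_level M g k < g x} \<le> ennreal ((1 / 2) ^ k)"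
proof (cases "dyadic_level M g k")
  case (real r)
  then have "decr_rearr M g ((1 / 2) ^ k) \<le> ennreal r"
    by (simp add: dyadic_level_def)
  then show ?thesis
    using real assms by (simp add: decr_rearr_le_iff)
qed simp

lemma emeasure_above_all_dyadic_levels:
  assumes [measurable]: "g \<in> borel_measurable M"
  shows "emeasure M {x \<in> space M. \<forall>k. dyadic_level M g k < g x} = 0" (is "?m = 0")
proof -
  have *: "?m \<le> ennreal ((1 / 2) ^ k)" for k
    by (rule order_trans[OF emeasure_mono emeasure_above_dyadic_level]) auto
  have "(\<lambda>k. ennreal ((1 / 2) ^ k)) \<longlonglongrightarrow> ennreal 0"
    by (intro tendsto_ennrealI LIMSEQ_realpow_zero) auto
  then have "?m \<le> ennreal 0"
    using * by (intro LIMSEQ_le_const) auto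
  then show ?thesis by simp
qed

text \<open>The lowest level vanishes: \<open>g\<^sub>*(1) = 0\<close> since the space has mass at most \<open>1\<close>. So a point
  with \<open>g x > 0\<close> that lies in no layer climbs above one level after the other.\<close>

lemma dyadic_layers_cover:
  assumes [measurable]: "g \<in> borel_measurable M" and mass: "emeasure M (space M) \<le> 1"
    and x: "x \<in> space M" "0 < g x"
  shows "(\<forall>k. dyadic_level M g k < g x) \<or> (\<exists>k. x \<in> dyadic_layer M g k)"
proof (rule disjCI)
  assume "\<not> (\<exists>k. x \<in> dyadic_layer M g k)"
  then have step: "dyadic_level M g (Suc k) < g x" if "dyadic_level M g k < g x" for k
    using that x(1) by (auto simp: dyadic_layer_def not_le)
  have "emeasure M {y \<in> space M. ennreal 0 < g y} \<le> 1"
    by (intro order_trans[OF emeasure_mono mass]) auto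
  then have "decr_rearr M g 1 \<le> ennreal 0"
    by (subst decr_rearr_le_iff) auto
  then have base: "dyadic_level M g 0 < g x"
    using x(2) by (simp add: dyadic_level_def)
  show "\<forall>k. dyadic_level M g k < g x"
  proof
    fix k show "dyadic_level M g k < g x"
      by (induction k) (fact base, rule step)
  qed
qed

text \<open>Fix \<open>s\<close> and put \<open>l = (4 / s)^(1/p) \<Lambda>\<close>; the set \<open>{|f\<^sub>0| > l}\<close> has to have measure at most
  \<open>s\<close>. It is covered by the layers with \<open>k\<close> outside the high indices and \<open>c_(k+1) > l\<close>, up to a
  null set. If there are such indices and \<open>k\<close> is the least one, then \<open>2^(-(k+2)/p) l < \<Lambda>\<close>, that is
  \<open>2^-k < s\<close>, and all these layers lie in \<open>{|f| > c\<^sub>k}\<close>, whose measure is at most \<open>2^-k\<close>.\<close>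

lemma weak_Lp_norm_low_part_le:
  assumes [measurable]: "f \<in> borel_measurable M" and mass: "emeasure M (space M) \<le> 1" and p: "0 < p"
    and \<Lambda>: "\<Lambda> < top"
  defines "g \<equiv> \<lambda>x. ennreal \<bar>f x\<bar>"
  shows "weak_Lp_norm M p (\<lambda>x. f x * indicator (- high_part M p g \<Lambda>) x) \<le> ennreal (4 powr (1 / p)) * \<Lambda>"
  unfolding weak_Lp_norm_def
proof (intro SUP_least)
  fix s :: real assume "s \<in> {0<..<1}"
  then have s: "0 < s" "s < 1" by auto
  have [measurable]: "g \<in> borel_measurable M"
    unfolding g_def by measurable
  obtain r where r: "0 \<le> r" "\<Lambda> = ennreal r"
    using \<Lambda> by (cases \<Lambda>) auto
  define l where "l = (4 / s) powr (1 / p) * r"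
  have l: "0 \<le> l" using r by (simp add: l_def)
  define g0 where "g0 x = ennreal \<bar>f x * indicator (- high_part M p g \<Lambda>) x\<bar>" for x
  have [measurable]: "g0 \<in> borel_measurable M"
    unfolding g0_def by measurable
  define N where "N = {x \<in> space M. \<forall>k. dyadic_level M g k < g x}"
  have N: "N \<in> sets M" "emeasure M N = 0"
    by (simp_all add: N_def emeasure_above_all_dyadic_levels)
  let ?P = "\<lambda>k. k \<notin> high_indices M p g \<Lambda> \<and> ennreal l < dyadic_level M g (Suc k)"
  have cover: "x \<in> N \<or> (\<exists>k. ?P k \<and> x \<in> dyadic_layer M g k)" if x: "x \<in> space M" "ennreal l < g0 x" for x
  proof -
    have low: "x \<notin> high_part M p g \<Lambda>"
      using x(2) by (cases "x \<in> high_part M p g \<Lambda>") (simp_all add: g0_def)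
    then have gx: "ennreal l < g x"
      using x(2) by (simp add: g0_def) (simp add: g_def)
    then have "0 < g x"
      by (metis le_less_trans zero_le)
    then consider "\<forall>k. dyadic_level M g k < g x" | k where "x \<in> dyadic_layer M g k"
      using dyadic_layers_cover[OF \<open>g \<in> _\<close> mass x(1)] by blast
    then show ?thesis
    proof cases
      case 2
      then have "ennreal l < dyadic_level M g (Suc k)" "k \<notin> high_indices M p g \<Lambda>"
        using low gx by (auto simp: high_part_def dyadic_layer_def)
      with 2 show ?thesis by blast
    qed (simp add: N_def x)
  qed
  have "emeasure M {x \<in> space M. ennreal l < g0 x} \<le> ennreal s"
  proof (cases "\<exists>k. ?P k")
    case False
    then have "{x \<in> space M. ennreal l < g0 x} \<subseteq> N"
      using cover by blast
    then have "emeasure M {x \<in> space M. ennreal l < g0 x} \<le> emeasure M N"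
      using N by (intro emeasure_mono) auto
    then show ?thesis
      using N by simp
  next
    case True
    define k where "k = (LEAST k. ?P k)"
    have k: "?P k"
      unfolding k_def using True by (rule LeastI_ex)
    define q where "q = ((1 / 2) ^ (k + 2)) powr (1 / p)"
    have q: "0 < q" by (simp add: q_def)
    have "ennreal l * ennreal q < dyadic_level M g (Suc k) * ennreal q"
      using k q by (intro ennreal_mult_strict_right_mono) auto
    also have "\<dots> \<le> ennreal r"
      using k by (simp add: high_indices_def q_def r not_less mult.commute)
    finally have "l * q < r"
      using l q r by (simp add: ennreal_less_iff flip: ennreal_mult)
    then have "((4 / s) * (1 / 2) ^ (k + 2)) powr (1 / p) * r < r"
      using s by (subst powr_mult) (auto simp: l_def q_def mult_ac simp del: power_Suc)
    then have "((4 / s) * (1 / 2) ^ (k + 2)) powr (1 / p) < 1 powr (1 / p)"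
      using r by (cases "r = 0") auto
    then have "(4 / s) * (1 / 2) ^ (k + 2) < 1"
      using powr_less_cancel2[of "1 / p" "(4 / s) * (1 / 2) ^ (k + 2)" 1] p s by simp
    then have small: "(1 / 2) ^ k < s"
      using s by (simp add: field_simps)
    have "{x \<in> space M. ennreal l < g0 x} \<subseteq> N \<union> {x \<in> space M. dyadic_level M g k < g x}"
    proof
      fix x assume "x \<in> {x \<in> space M. ennreal l < g0 x}"
      then consider "x \<in> N" | j where "?P j" "x \<in> dyadic_layer M g j"
        using cover by blast
      then show "x \<in> N \<union> {x \<in> space M. dyadic_level M g k < g x}"
      proof cases
        case 2
        then have "k \<le> j"
          unfolding k_def by (intro Least_le)
        from dyadic_level_mono[OF this, of M g] 2 show ?thesis
          by (auto simp: dyadic_layer_def intro: le_less_trans)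
      qed simp
    qed
    then have "emeasure M {x \<in> space M. ennreal l < g0 x}
        \<le> emeasure M (N \<union> {x \<in> space M. dyadic_level M g k < g x})"
      using N by (intro emeasure_mono) auto
    also have "\<dots> \<le> emeasure M N + emeasure M {x \<in> space M. dyadic_level M g k < g x}"
      using N by (intro emeasure_subadditive) auto
    also have "\<dots> \<le> ennreal ((1 / 2) ^ k)"
      using N emeasure_above_dyadic_level[OF \<open>g \<in> _\<close>] by simp
    also have "\<dots> \<le> ennreal s"
      using small by (intro ennreal_leI) simp
    finally show ?thesis .
  qed
  then have "decr_rearr M g0 s \<le> ennreal l"
    using l by (simp add: decr_rearr_le_iff)
  then have "ennreal (s powr (1 / p)) * decr_rearr M g0 s \<le> ennreal (s powr (1 / p)) * ennreal l"
    by (intro mult_left_mono) auto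
  also have "\<dots> = ennreal (s powr (1 / p) * l)"
    using l by (simp add: ennreal_mult)
  also have "s powr (1 / p) * l = 4 powr (1 / p) * r"
    using s by (simp add: l_def powr_divide)
  finally show "ennreal (s powr (1 / p)) * decr_rearr M (\<lambda>x. ennreal \<bar>f x * indicator (- high_part M p g \<Lambda>) x\<bar>) s
      \<le> ennreal (4 powr (1 / p)) * \<Lambda>"
    using r by (simp add: g0_def[abs_def] ennreal_mult)
qed

text \<open>On the \<open>k\<close>-th layer, of measure at most \<open>2^-k\<close>, \<open>|f| \<le> c_(k+1)\<close>; on the interval
  \<open>(2^(-k-2), 2^(-k-1))\<close>, of length \<open>2^-k / 4\<close>, \<open>f\<^sub>* \<ge> c_(k+1)\<close>. For high indices these intervals
  lie in \<open>{\<psi> > \<Lambda>}\<close>, and they are disjoint, so the contributions of the layers add up to at most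
  \<open>4\<close> times the integral.\<close>

lemma nn_integral_high_part_le:
  assumes [measurable]: "f \<in> borel_measurable M" and p: "0 < p"
  defines "g \<equiv> \<lambda>x. ennreal \<bar>f x\<bar>"
  shows "(\<integral>\<^sup>+x. epowr (ennreal \<bar>f x * indicator (high_part M p g \<Lambda>) x\<bar>) p \<partial>M)
    \<le> 4 * (\<integral>\<^sup>+s\<in>{s. \<Lambda> < psi M p f s}. epowr (psi M p f s) p \<partial>nu)"
proof -
  have [measurable]: "g \<in> borel_measurable M"
    unfolding g_def by measurable
  define w where "w k = (if k \<in> high_indices M p g \<Lambda> then epowr (dyadic_level M g (Suc k)) p else 0)" for k
  define D where "D k = {(1 / 2) ^ (k + 2)<..<(1 / 2 :: real) ^ (k + 1)}" for k :: nat
  let ?L = "lebesgue_on {0<..<1::real}"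
  have D_sub: "D k \<subseteq> {0<..<1}" for k
  proof
    fix s assume "s \<in> D k"
    moreover have "(1 / 2 :: real) ^ (k + 1) \<le> 1" "0 < (1 / 2 :: real) ^ (k + 2)"
      by (auto intro: power_le_one simp del: power_Suc)
    ultimately show "s \<in> {0<..<1}"
      unfolding D_def greaterThanLessThan_iff by linarith
  qed
  then have [measurable]: "D k \<in> sets ?L" for k
    by (auto simp: sets_restrict_space_iff D_def)
  have "n \<le> m" if "s \<in> D m" "s \<in> D n" for m n s
  proof -
    have "(1 / 2 :: real) ^ (m + 2) < (1 / 2) ^ (n + 1)"
      using that unfolding D_def greaterThanLessThan_iff by linarith
    then show ?thesis
      by (subst (asm) power_strict_decreasing_iff) auto
  qed
  then have "disjoint_family D"
    unfolding disjoint_family_on_def by (blast intro: antisym)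
  have "(\<integral>\<^sup>+x. epowr (ennreal \<bar>f x * indicator (high_part M p g \<Lambda>) x\<bar>) p \<partial>M)
      \<le> (\<integral>\<^sup>+x. (\<Sum>k. w k * indicator (dyadic_layer M g k) x) \<partial>M)"
  proof (intro nn_integral_mono)
    fix x
    show "epowr (ennreal \<bar>f x * indicator (high_part M p g \<Lambda>) x\<bar>) p
        \<le> (\<Sum>k. w k * indicator (dyadic_layer M g k) x)"
    proof (cases "x \<in> high_part M p g \<Lambda>")
      case True
      then obtain k where k: "k \<in> high_indices M p g \<Lambda>" "x \<in> dyadic_layer M g k"
        by (auto simp: high_part_def)
      then have "epowr (g x) p \<le> w k * indicator (dyadic_layer M g k) x"
        using p by (auto simp: w_def dyadic_layer_def intro: epowr_mono)
      also have "\<dots> \<le> (\<Sum>k. w k * indicator (dyadic_layer M g k) x)"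
        by (meson ennreal_suminf_lessD less_irrefl not_le)
      finally show ?thesis
        using True by (simp add: g_def)
    qed simp
  qed
  also have "\<dots> = (\<Sum>k. w k * emeasure M (dyadic_layer M g k))"
    by (subst nn_integral_suminf) (auto simp: nn_integral_cmult_indicator)
  also have "\<dots> \<le> (\<Sum>k. 4 * (w k * ennreal ((1 / 2) ^ (k + 2))))"
  proof (intro suminf_le summableI)
    fix k
    have "emeasure M (dyadic_layer M g k) \<le> ennreal ((1 / 2) ^ k)"
      by (rule order_trans[OF emeasure_mono emeasure_above_dyadic_level[OF \<open>g \<in> _\<close>]])
        (auto simp: dyadic_layer_def)
    also have "\<dots> = 4 * ennreal ((1 / 2) ^ (k + 2))"
      using ennreal_mult[of 4 "(1 / 2) ^ (k + 2)"] by simp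
    finally have "w k * emeasure M (dyadic_layer M g k) \<le> w k * (4 * ennreal ((1 / 2) ^ (k + 2)))"
      by (intro mult_left_mono) auto
    then show "w k * emeasure M (dyadic_layer M g k) \<le> 4 * (w k * ennreal ((1 / 2) ^ (k + 2)))"
      by (simp only: mult_ac)
  qed
  also have "\<dots> = 4 * (\<Sum>k. w k * ennreal ((1 / 2) ^ (k + 2)))"
    by (rule ennreal_suminf_cmult)
  also have "(\<Sum>k. w k * ennreal ((1 / 2) ^ (k + 2))) = (\<Sum>k. w k * emeasure ?L (D k))"
  proof (intro suminf_cong arg_cong2[where f="(*)"] refl)
    fix k :: nat
    have "emeasure ?L (D k) = emeasure lborel (D k)"
      using D_sub[of k]
      by (subst emeasure_restrict_space) (auto simp: D_def)
    also have "\<dots> = ennreal ((1 / 2) ^ (k + 1) - (1 / 2) ^ (k + 2))"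
      unfolding D_def by (subst emeasure_lborel_Ioo) auto
    finally show "ennreal ((1 / 2) ^ (k + 2)) = emeasure ?L (D k)"
      by simp
  qed
  also have "\<dots> = (\<integral>\<^sup>+s. (\<Sum>k. w k * indicator (D k) s) \<partial>?L)"
    by (subst nn_integral_suminf) (auto simp: nn_integral_cmult_indicator)
  also have "\<dots> \<le> (\<integral>\<^sup>+s\<in>{s. \<Lambda> < psi M p f s}. epowr (decr_rearr M g s) p \<partial>?L)"
  proof (intro nn_integral_mono)
    fix s
    show "(\<Sum>k. w k * indicator (D k) s)
        \<le> epowr (decr_rearr M g s) p * indicator {s. \<Lambda> < psi M p f s} s"
    proof (cases "\<exists>k\<in>high_indices M p g \<Lambda>. s \<in> D k")
      case True
      then obtain k where k: "k \<in> high_indices M p g \<Lambda>" "s \<in> D k"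
        by blast
      have "(\<Sum>k. w k * indicator (D k) s) = w k"
        using \<open>disjoint_family D\<close> k(2) by (rule suminf_cmult_indicator)
      moreover have level: "dyadic_level M g (Suc k) \<le> decr_rearr M g s"
        using k(2) unfolding dyadic_level_def D_def by (intro decr_rearr_antimono) auto
      moreover have "\<Lambda> < psi M p f s"
      proof -
        have "\<Lambda> < ennreal (((1 / 2) ^ (k + 2)) powr (1 / p)) * dyadic_level M g (Suc k)"
          using k(1) by (simp add: high_indices_def)
        also have "\<dots> \<le> ennreal (s powr (1 / p)) * decr_rearr M g s"
          using level k(2) p
          by (intro mult_mono ennreal_leI powr_mono2) (auto simp: D_def)
        finally show ?thesis
          by (simp add: psi_def g_def)
      qed
      ultimately show ?thesis
        using k(1) p by (auto simp: w_def intro: epowr_mono)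
    next
      case False
      then have "(\<lambda>k. w k * indicator (D k) s) = (\<lambda>k. 0)"
        by (auto simp: w_def fun_eq_iff)
      then show ?thesis by simp
    qed
  qed
  also have "\<dots> = (\<integral>\<^sup>+s\<in>{s. \<Lambda> < psi M p f s}. epowr (psi M p f s) p \<partial>nu)"
    using p unfolding psi_def g_def[symmetric] by (subst nn_integral_nu_weighted) (auto)
  finally show ?thesis
    by (simp add: mult_left_mono)
qed

text \<open>With \<open>T = t^-p\<close>, the rearrangement is at least \<open>\<psi>\<^sub>*(T)\<close> on \<open>(0,T)\<close>, so that
  \<open>K\<^sub>0 \<ge> t (T \<psi>\<^sub>*(T)^p)^(1/p) = \<psi>\<^sub>*(T)\<close>.\<close>

lemma decr_rearr_le_K0:
  assumes p: "0 < p" and t: "0 < t"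
  shows "decr_rearr nu (psi M p f) (t powr (- p)) \<le> K0 M p f t"
proof -
  define T where "T = t powr (- p)"
  define \<Lambda> where "\<Lambda> = decr_rearr nu (psi M p f) T"
  define I where "I = (\<integral>\<^sup>+x\<in>{0<..<T}. epowr (decr_rearr nu (psi M p f) x) p \<partial>lborel)"
  have "epowr \<Lambda> p * ennreal T = (\<integral>\<^sup>+x. epowr \<Lambda> p * indicator {0<..<T} x \<partial>lborel)"
    by (simp add: nn_integral_cmult_indicator T_def)
  also have "\<dots> \<le> I"
    unfolding I_def \<Lambda>_def using p
    by (intro nn_integral_mono) (auto simp: indicator_def intro!: epowr_mono decr_rearr_antimono)
  finally have "epowr (epowr \<Lambda> p * ennreal T) (1 / p) \<le> epowr I (1 / p)"
    using p by (intro epowr_mono) auto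
  then have "\<Lambda> * ennreal (1 / t) \<le> epowr I (1 / p)"
    using p t powr_neg_one[of t] by (simp add: epowr_mult T_def powr_powr)
  then have "ennreal t * (\<Lambda> * ennreal (1 / t)) \<le> K0 M p f t"
    unfolding K0_def I_def T_def by (intro mult_left_mono) auto
  moreover have "ennreal t * (\<Lambda> * ennreal (1 / t)) = \<Lambda>"
  proof -
    have "ennreal t * ennreal (1 / t) = 1"
      using t by (simp flip: ennreal_mult)
    then show ?thesis
      by (metis mult.left_commute mult.right_neutral)
  qed
  ultimately show ?thesis
    by (simp add: \<Lambda>_def T_def)
qed

text \<open>Each of the two parts of \<open>f\<close> costs at most \<open>4^(1/p) K\<^sub>0\<close>. That \<open>K\<^sub>0\<close> is finite makes both
  parts members of their spaces; otherwise the right-hand side is infinite.\<close>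

lemma K_functional_le_K0:
  assumes [measurable]: "f \<in> borel_measurable M" and mass: "emeasure M (space M) \<le> 1"
    and p: "0 < p" and t: "0 < t"
  shows "K_functional M (weak_Lp_norm M p) (Lp_norm M p) f t
    \<le> ennreal (2 * 4 powr (1 / p)) * K0 M p f t"
proof (cases "K0 M p f t = top")
  case True
  then show ?thesis by (simp add: ennreal_mult_top)
next
  case False
  then have fin: "K0 M p f t < top"
    by (simp add: less_top)
  define T where "T = t powr (- p)"
  define \<Lambda> where "\<Lambda> = decr_rearr nu (psi M p f) T"
  define I where "I = (\<integral>\<^sup>+x\<in>{0<..<T}. epowr (decr_rearr nu (psi M p f) x) p \<partial>lborel)"
  define B where "B = high_part M p (\<lambda>x. ennreal \<bar>f x\<bar>) \<Lambda>"
  define f0 where "f0 x = f x * indicator (- B) x" for x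
  define f1 where "f1 x = f x * indicator B x" for x
  let ?C = "ennreal (4 powr (1 / p))"
  have [measurable]: "B \<in> sets M"
    unfolding B_def by measurable
  have meas: "f0 \<in> borel_measurable M" "f1 \<in> borel_measurable M"
    unfolding f0_def f1_def by measurable
  have \<Lambda>_le: "\<Lambda> \<le> K0 M p f t"
    unfolding \<Lambda>_def T_def by (rule decr_rearr_le_K0[OF p t])
  then have \<Lambda>: "\<Lambda> < top"
    using fin by (rule le_less_trans)
  have f0: "weak_Lp_norm M p f0 \<le> ?C * K0 M p f t"
  proof -
    have "weak_Lp_norm M p f0 \<le> ?C * \<Lambda>"
      unfolding f0_def B_def by (rule weak_Lp_norm_low_part_le[OF _ mass p \<Lambda>]) measurable
    also have "\<dots> \<le> ?C * K0 M p f t"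
      by (intro mult_left_mono \<Lambda>_le) auto
    finally show ?thesis .
  qed
  have psi_nu [measurable]: "psi M p f \<in> borel_measurable nu"
    by (intro borel_measurable_nuI) measurable
  define E where "E = {s \<in> space nu. \<Lambda> < psi M p f s}"
  have E: "E \<in> sets nu"
    unfolding E_def by measurable
  obtain r where r: "0 \<le> r" "\<Lambda> = ennreal r"
    using \<Lambda> by (cases \<Lambda>) auto
  \<comment> \<open>\<open>\<Lambda>\<close> is itself an admissible level in the infimum that defines it.\<close>
  then have "emeasure nu E \<le> ennreal T"
    using decr_rearr_le_iff[OF psi_nu, of r T] by (simp add: \<Lambda>_def E_def)
  then have "(\<integral>\<^sup>+s\<in>E. epowr (psi M p f s) p \<partial>nu) \<le> I"
    unfolding I_def by (intro nn_integral_le_decr_rearr sigma_finite_nu psi_nu E p)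
  moreover have "(\<integral>\<^sup>+s\<in>{s. \<Lambda> < psi M p f s}. epowr (psi M p f s) p \<partial>nu)
      = (\<integral>\<^sup>+s\<in>E. epowr (psi M p f s) p \<partial>nu)"
    by (intro nn_integral_cong) (auto simp: E_def indicator_def)
  moreover have "(\<integral>\<^sup>+x. epowr (ennreal \<bar>f1 x\<bar>) p \<partial>M)
      \<le> 4 * (\<integral>\<^sup>+s\<in>{s. \<Lambda> < psi M p f s}. epowr (psi M p f s) p \<partial>nu)"
    unfolding f1_def B_def by (rule nn_integral_high_part_le[OF _ p]) measurable
  ultimately have "(\<integral>\<^sup>+x. epowr (ennreal \<bar>f1 x\<bar>) p \<partial>M) \<le> 4 * I"
    by (simp add: order_trans mult_left_mono)
  then have "Lp_norm M p f1 \<le> epowr (4 * I) (1 / p)"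
    using p by (simp add: Lp_norm_def epowr_mono)
  also have "\<dots> = ?C * epowr I (1 / p)"
    using p epowr_ennreal[of 4 "1 / p"] by (simp add: epowr_mult)
  finally have "ennreal t * Lp_norm M p f1 \<le> ennreal t * (?C * epowr I (1 / p))"
    by (rule mult_left_mono) simp
  then have f1: "ennreal t * Lp_norm M p f1 \<le> ?C * K0 M p f t"
    by (simp add: K0_def I_def T_def mult.left_commute)
  have bound: "?C * K0 M p f t < top"
    using fin by (simp add: ennreal_mult_less_top)
  have "f0 \<in> fun_space M (weak_Lp_norm M p)"
    using le_less_trans[OF f0 bound] meas by (simp add: fun_space_def)
  moreover have "f1 \<in> fun_space M (Lp_norm M p)"
    using le_less_trans[OF f1 bound] t meas by (auto simp: fun_space_def ennreal_mult_less_top)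
  moreover have "AE x in M. f x = f0 x + f1 x"
    by (auto simp: f0_def f1_def indicator_def)
  ultimately have "(f0, f1) \<in> decompositions M (fun_space M (weak_Lp_norm M p)) (fun_space M (Lp_norm M p)) f"
    by (simp add: decompositions_def)
  then have "K_functional M (weak_Lp_norm M p) (Lp_norm M p) f t
      \<le> weak_Lp_norm M p f0 + ennreal t * Lp_norm M p f1"
    unfolding K_functional_def by (rule INF_lower2) simp
  also have "\<dots> \<le> ?C * K0 M p f t + ?C * K0 M p f t"
    by (intro add_mono f0 f1)
  also have "\<dots> = 2 * ?C * K0 M p f t"
    by (simp only: mult_2 distrib_right)
  also have "2 * ?C = ennreal (2 * 4 powr (1 / p))"
    by (simp add: ennreal_mult)
  finally show ?thesis .
qed

lemma K0_le_K_functional: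
  assumes M: "sigma_finite_measure M" and f: "f \<in> borel_measurable M" and p: "0 < p" and t: "0 < t"
  shows "ennreal (1 / (2 * 4 powr (1 / p))) * K0 M p f t
    \<le> K_functional M (weak_Lp_norm M p) (Lp_norm M p) f t"
  unfolding K_functional_def
proof (rule INF_greatest, clarify)
  fix f0 f1
  assume "(f0, f1) \<in> decompositions M (fun_space M (weak_Lp_norm M p)) (fun_space M (Lp_norm M p)) f"
  then have f01: "f0 \<in> borel_measurable M" "f1 \<in> borel_measurable M" "AE x in M. f x = f0 x + f1 x"
    by (auto simp: decompositions_def fun_space_def)
  define c where "c = 2 * 4 powr (1 / p)"
  have c: "ennreal (1 / c) * ennreal c = 1" "0 < c"
    by (simp_all add: c_def flip: ennreal_mult)
  let ?N = "weak_Lp_norm M p f0 + ennreal t * Lp_norm M p f1"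
  have "ennreal (1 / c) * K0 M p f t \<le> ennreal (1 / c) * (ennreal c * ?N)"
    unfolding c_def by (intro mult_left_mono K0_le_decomposition M f f01 p t) auto
  also have "\<dots> = ?N"
    by (simp only: c(1) mult_1_left flip: mult.assoc)
  finally show "ennreal (1 / (2 * 4 powr (1 / p))) * K0 M p f t \<le> ?N"
    by (simp add: c_def)
qed

theorem theorem1p11:
  fixes \<Omega> :: "(real ^ 'n) set" and p :: real
  assumes "open \<Omega>" and "bounded \<Omega>" and "emeasure lebesgue \<Omega> = 1" and "1 \<le> p"
  defines "M \<equiv> lebesgue_on \<Omega>"
  shows "\<exists>c1>0. \<exists>c2>0. \<forall>t>0.
    \<forall>f \<in> sum_space M (fun_space M (Lp_norm M p)) (fun_space M (weak_Lp_norm M p)).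
      (AE x in M. 0 \<le> f x) \<longrightarrow>
        ennreal c1 * K0 M p f t \<le> K_functional M (weak_Lp_norm M p) (Lp_norm M p) f t \<and>
        K_functional M (weak_Lp_norm M p) (Lp_norm M p) f t \<le> ennreal c2 * K0 M p f t"
proof -
  have "\<Omega> \<in> lmeasurable"
    using assms by (simp add: lmeasurable_open)
  then have sf: "sigma_finite_measure M"
    unfolding M_def by (intro finite_measure.axioms finite_measure_lebesgue_on)
  have mass: "emeasure M (space M) \<le> 1"
    using assms \<open>\<Omega> \<in> lmeasurable\<close> by (simp add: M_def emeasure_restrict_space fmeasurableD)
  have p: "0 < p"
    using \<open>1 \<le> p\<close> by simp
  define c where "c = 2 * 4 powr (1 / p)"
  then have c: "0 < c" "0 < 1 / c"
    by simp_all
  show ?thesis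
  proof (rule exI[of _ "1 / c"], rule conjI[OF c(2)], rule exI[of _ c], rule conjI[OF c(1)],
      intro allI ballI impI conjI)
    fix t :: real and f
    assume "0 < t" and "f \<in> sum_space M (fun_space M (Lp_norm M p)) (fun_space M (weak_Lp_norm M p))"
    then have f: "f \<in> borel_measurable M"
      by (simp add: sum_space_def)
    show "ennreal (1 / c) * K0 M p f t \<le> K_functional M (weak_Lp_norm M p) (Lp_norm M p) f t"
      unfolding c_def by (rule K0_le_K_functional[OF sf f p \<open>0 < t\<close>])
    show "K_functional M (weak_Lp_norm M p) (Lp_norm M p) f t \<le> ennreal c * K0 M p f t"
      unfolding c_def by (rule K_functional_le_K0[OF f mass p \<open>0 < t\<close>])
  qed
qed

end
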